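(* Fix $x\in\mathbb R^d$ and let $\chi_x\in C_c^\infty(\mathbb R^d)$ equal one on an open neighborhood of $x$. For $r,s\in\{1,\dots,d\}$ put $$g_{r,x}(y)=\chi_x(y)y_r,\quad g_{rs,x}(y)=\chi_x(y)y_ry_s,\quad \widetilde g_{r,x}(y)=\chi_x(y)(y_r-x_r),\quad \widetilde g_{rs,x}(y)=\chi_x(y)(y_r-x_r)(y_s-x_s).$$ Suppose that for each $i\in S$ the functions $b(\cdot,i),\sigma(\cdot,i)$ are in $C^4(\mathbb R^d)$ with bounded derivatives of orders $1,\dots,4$, that for $i\ne j$ the intensities $q_{ij}\ge0$ are in $C^4(\mathbb R^d)$ with bounded derivatives of orders $1,\dots,4$, and that $\sup_i\sup_yq_i(y)<\infty$. Then for $i\ne j$ in $S$, $$q_{ij}(x)=A_1^{ij}1(x),\qquad q_i(x)=-A_1^{ii}1(x),$$ and for all $i\in S$, $r,s\in\{1,\dots,d\}$, $$b_r(x,i)=A_1^{ii}g_{r,x}(x)+q_i(x)x_r=A_1^{ii}\widetilde g_{r,x}(x),$$ $$a_{rs}(x,i)=A_1^{ii}g_{rs,x}(x)+q_i(x)x_rx_s-x_sb_r(x,i)-x_rb_s(x,i)=A_1^{ii}\widetilde g_{rs,x}(x).$$ These identities do not depend on the choice of $\chi_x$. Consequently, the family of first block-generator coefficients at $x$ generated by locally constant, linear and quadratic probes determines the vector $\bigl(\{q_{ij}(x):i\ne j\},\{b(x,i):i\in S\},\{a(x,i):i\in S\}\bigr)$.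
   Context: $S$ is a finite set with $|S|\ge2$, $E=\mathbb R^d\times S$; $b:\mathbb R^d\times S\to\mathbb R^d$, $\sigma:\mathbb R^d\times S\to\mathbb R^{d\times r_0}$ ($r_0\ge1$) and $q_{ij}:\mathbb R^d\to[0,\infty)$ ($i\ne j$) are the drift, diffusion coefficient and state-dependent switching intensities of a regime-switching diffusion $(X_t,\Lambda_t)$ on $E$. Write $q_i=\sum_{j\ne i}q_{ij}$, $a=\sigma\sigma^\top$ with entries $a_{rs}$. For $f:E\to\mathbb R$ with $C^2$ regime components, $$\mathcal Lf(x,i)=b(x,i)^\top\nabla_xf(x,i)+\tfrac12\operatorname{tr}\bigl(a(x,i)\nabla_x^2f(x,i)\bigr)+\sum_{j\ne i}q_{ij}(x)\bigl(f(x,j)-f(x,i)\bigr).$$ With $f_g^{(j)}(y,\ell)=g(y)\mathbf 1_{\{\ell=j\}}$, the first block-generator coefficient is $A_1^{ij}g(x)=(\mathcal Lf_g^{(j)})(x,i)$. For the constant probe, $A_1^{ij}1(x):=A_1^{ij}\chi(x)$ for any smooth compactly supported cutoff $\chi$, $0\le\chi\le1$, with $\chi=1$ on a neighborhood of $x$ (the value is independent of the cutoff). *)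

theory Defs
  imports "HOL-Analysis.Analysis"
begin

definition partial_deriv ::
    "'d \<Rightarrow> (real^'d \<Rightarrow> 'b::real_normed_vector) \<Rightarrow> real^'d \<Rightarrow> 'b" where
  "partial_deriv r f x = frechet_derivative f (at x) (axis r 1)"

primrec iter_partial ::
    "'d list \<Rightarrow> (real^'d \<Rightarrow> 'b::real_normed_vector) \<Rightarrow> real^'d \<Rightarrow> 'b" where
  "iter_partial [] f = f"
| "iter_partial (r # rs) f = partial_deriv r (iter_partial rs f)"

text \<open>\<^const>\<open>frechet_derivative\<close> is unspecified at points of non-differentiability, so
  the differentiability of the lower-order partial derivatives is demanded explicitly.\<close>

definition C_k :: "nat \<Rightarrow> (real^'d \<Rightarrow> 'b::real_normed_vector) \<Rightarrow> bool" where
  "C_k k f \<longleftrightarrow>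
     (\<forall>rs. length rs < k \<longrightarrow> iter_partial rs f differentiable_on UNIV) \<and>
     (\<forall>rs. length rs \<le> k \<longrightarrow> continuous_on UNIV (iter_partial rs f))"

definition bounded_derivs :: "nat \<Rightarrow> (real^'d \<Rightarrow> 'b::real_normed_vector) \<Rightarrow> bool" where
  "bounded_derivs k f \<longleftrightarrow>
     (\<forall>rs. 1 \<le> length rs \<and> length rs \<le> k \<longrightarrow> bounded (range (iter_partial rs f)))"

definition gradient :: "(real^'d \<Rightarrow> real) \<Rightarrow> real^'d \<Rightarrow> real^'d" where
  "gradient f x = (\<chi> r. partial_deriv r f x)"

definition hessian :: "(real^'d \<Rightarrow> real) \<Rightarrow> real^'d \<Rightarrow> real^'d^'d" where
  "hessian f x = (\<chi> r s. partial_deriv r (partial_deriv s f) x)"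

definition test_function :: "(real^'d \<Rightarrow> real) \<Rightarrow> bool" where
  "test_function f \<longleftrightarrow> (\<forall>k. C_k k f) \<and> compact (closure {y. f y \<noteq> 0})"

definition cutoff_at :: "real^'d \<Rightarrow> (real^'d \<Rightarrow> real) \<Rightarrow> bool" where
  "cutoff_at x \<psi> \<longleftrightarrow>
     test_function \<psi> \<and> (\<exists>U. open U \<and> x \<in> U \<and> (\<forall>y\<in>U. \<psi> y = 1))"

definition unit_cutoff_at :: "real^'d \<Rightarrow> (real^'d \<Rightarrow> real) \<Rightarrow> bool" where
  "unit_cutoff_at x \<eta> \<longleftrightarrow> cutoff_at x \<eta> \<and> (\<forall>y. 0 \<le> \<eta> y \<and> \<eta> y \<le> 1)"

text \<open>Diagonal entries \<open>q i i\<close> of the intensity family carry no meaning and are never used.\<close>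

definition total_rate ::
    "('s::finite \<Rightarrow> 's \<Rightarrow> real^'d \<Rightarrow> real) \<Rightarrow> 's \<Rightarrow> real^'d \<Rightarrow> real" where
  "total_rate q i x = (\<Sum>j\<in>UNIV - {i}. q i j x)"

definition diffusion_matrix ::
    "((real^'d) \<times> 's \<Rightarrow> real^'r^'d) \<Rightarrow> (real^'d) \<times> 's \<Rightarrow> real^'d^'d" where
  "diffusion_matrix \<sigma> z = \<sigma> z ** transpose (\<sigma> z)"

definition generator ::
    "((real^'d) \<times> 's \<Rightarrow> real^'d) \<Rightarrow> ((real^'d) \<times> 's \<Rightarrow> real^'r^'d) \<Rightarrow>
     ('s::finite \<Rightarrow> 's \<Rightarrow> real^'d \<Rightarrow> real) \<Rightarrow>
     ((real^'d) \<times> 's \<Rightarrow> real) \<Rightarrow> (real^'d) \<times> 's \<Rightarrow> real" where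
  "generator b \<sigma> q f = (\<lambda>(x, i).
       b (x, i) \<bullet> gradient (\<lambda>y. f (y, i)) x
     + 1 / 2 * trace (diffusion_matrix \<sigma> (x, i) ** hessian (\<lambda>y. f (y, i)) x)
     + (\<Sum>j\<in>UNIV - {i}. q i j x * (f (x, j) - f (x, i))))"

definition regime_lift :: "'s \<Rightarrow> (real^'d \<Rightarrow> real) \<Rightarrow> (real^'d) \<times> 's \<Rightarrow> real" where
  "regime_lift j g = (\<lambda>(y, l). g y * indicator {j} l)"

definition A1 ::
    "((real^'d) \<times> 's \<Rightarrow> real^'d) \<Rightarrow> ((real^'d) \<times> 's \<Rightarrow> real^'r^'d) \<Rightarrow>
     ('s::finite \<Rightarrow> 's \<Rightarrow> real^'d \<Rightarrow> real) \<Rightarrow>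
     's \<Rightarrow> 's \<Rightarrow> (real^'d \<Rightarrow> real) \<Rightarrow> real^'d \<Rightarrow> real" where
  "A1 b \<sigma> q i j g x = generator b \<sigma> q (regime_lift j g) (x, i)"

definition regular_coefficients ::
    "((real^'d) \<times> 's \<Rightarrow> real^'d) \<Rightarrow> ((real^'d) \<times> 's \<Rightarrow> real^'r^'d) \<Rightarrow>
     ('s::finite \<Rightarrow> 's \<Rightarrow> real^'d \<Rightarrow> real) \<Rightarrow> bool" where
  "regular_coefficients b \<sigma> q \<longleftrightarrow>
     (\<forall>i. C_k 4 (\<lambda>y. b (y, i)) \<and> bounded_derivs 4 (\<lambda>y. b (y, i))) \<and>
     (\<forall>i. C_k 4 (\<lambda>y. \<sigma> (y, i)) \<and> bounded_derivs 4 (\<lambda>y. \<sigma> (y, i))) \<and>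
     (\<forall>i j. i \<noteq> j \<longrightarrow> (\<forall>y. 0 \<le> q i j y) \<and> C_k 4 (q i j) \<and> bounded_derivs 4 (q i j)) \<and>
     bdd_above (range (\<lambda>(y, i). total_rate q i y))"

definition lin_probe :: "(real^'d \<Rightarrow> real) \<Rightarrow> 'd \<Rightarrow> real^'d \<Rightarrow> real" where
  "lin_probe \<psi> r y = \<psi> y * y $ r"

definition quad_probe :: "(real^'d \<Rightarrow> real) \<Rightarrow> 'd \<Rightarrow> 'd \<Rightarrow> real^'d \<Rightarrow> real" where
  "quad_probe \<psi> r s y = \<psi> y * y $ r * y $ s"

definition centered_lin_probe ::
    "(real^'d \<Rightarrow> real) \<Rightarrow> real^'d \<Rightarrow> 'd \<Rightarrow> real^'d \<Rightarrow> real" where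
  "centered_lin_probe \<psi> x r y = \<psi> y * (y $ r - x $ r)"

definition centered_quad_probe ::
    "(real^'d \<Rightarrow> real) \<Rightarrow> real^'d \<Rightarrow> 'd \<Rightarrow> 'd \<Rightarrow> real^'d \<Rightarrow> real" where
  "centered_quad_probe \<psi> x r s y = \<psi> y * (y $ r - x $ r) * (y $ s - x $ s)"

text \<open>The cutoff \<open>\<eta>\<close> realises the constant probe, the cutoff \<open>\<psi>\<close> localises the linear and
  quadratic ones; only the former is required to take values in \<open>{0..1}\<close>.\<close>

definition probe_family ::
    "((real^'d) \<times> 's \<Rightarrow> real^'d) \<Rightarrow> ((real^'d) \<times> 's \<Rightarrow> real^'r^'d) \<Rightarrow>
     ('s::finite \<Rightarrow> 's \<Rightarrow> real^'d \<Rightarrow> real) \<Rightarrow>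
     (real^'d \<Rightarrow> real) \<Rightarrow> (real^'d \<Rightarrow> real) \<Rightarrow> real^'d \<Rightarrow>
     ('s \<Rightarrow> 's \<Rightarrow> real) \<times> ('s \<Rightarrow> 's \<Rightarrow> 'd \<Rightarrow> real) \<times> ('s \<Rightarrow> 's \<Rightarrow> 'd \<Rightarrow> 'd \<Rightarrow> real)" where
  "probe_family b \<sigma> q \<eta> \<psi> x =
     (\<lambda>i j. A1 b \<sigma> q i j \<eta> x,
      \<lambda>i j r. A1 b \<sigma> q i j (lin_probe \<psi> r) x,
      \<lambda>i j r s. A1 b \<sigma> q i j (quad_probe \<psi> r s) x)"

definition centered_probe_family ::
    "((real^'d) \<times> 's \<Rightarrow> real^'d) \<Rightarrow> ((real^'d) \<times> 's \<Rightarrow> real^'r^'d) \<Rightarrow>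
     ('s::finite \<Rightarrow> 's \<Rightarrow> real^'d \<Rightarrow> real) \<Rightarrow>
     (real^'d \<Rightarrow> real) \<Rightarrow> (real^'d \<Rightarrow> real) \<Rightarrow> real^'d \<Rightarrow>
     ('s \<Rightarrow> 's \<Rightarrow> real) \<times> ('s \<Rightarrow> 's \<Rightarrow> 'd \<Rightarrow> real) \<times> ('s \<Rightarrow> 's \<Rightarrow> 'd \<Rightarrow> 'd \<Rightarrow> real)" where
  "centered_probe_family b \<sigma> q \<eta> \<psi> x =
     (\<lambda>i j. A1 b \<sigma> q i j \<eta> x,
      \<lambda>i j r. A1 b \<sigma> q i j (centered_lin_probe \<psi> x r) x,
      \<lambda>i j r s. A1 b \<sigma> q i j (centered_quad_probe \<psi> x r s) x)"

end

theory Submission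
  imports Defs
begin

text \<open>Since differentiation is local, a cutoff that equals one near \<open>x\<close> has no effect on the
  gradient and Hessian of a probe at \<open>x\<close>: there the probe is a polynomial of degree at
  most two in the coordinates.  The diagonal block coefficient is
  \<^term>\<open>A1 b \<sigma> q i i g x = b (x, i) \<bullet> gradient g x
    + 1 / 2 * trace (diffusion_matrix \<sigma> (x, i) ** hessian g x) - total_rate q i x * g x\<close>,
  since the lift of \<open>g\<close> vanishes in every regime other than \<open>i\<close>; off the diagonal only the
  jump from \<open>i\<close> into \<open>j\<close> survives, giving \<^term>\<open>q i j x * g x\<close>.

  So a constant probe has only the jump term, a linear probe reads off one drift component,
  and a quadratic probe has a constant Hessian, supported at the entries \<open>(r, s)\<close> and
  \<open>(s, r)\<close>, whose trace against the symmetric diffusion matrix is twice the entry \<open>(r, s)\<close>; the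
  factor one half cancels the two.  What remains are lower-order terms that are known from the
  preceding probes; centring the probe at \<open>x\<close> makes them vanish.  The probe
  values are thus functions of \<open>x\<close> and of the coefficients at \<open>x\<close>, hence independent of the cutoff,
  and solving for the coefficients in turn gives identifiability.\<close>

section \<open>Locality of the first and second derivatives\<close>

lemma frechet_derivative_cong_germ:
  assumes "\<forall>\<^sub>F y in nhds x. f y = g y"
  shows "frechet_derivative f (at x) = frechet_derivative g (at x)"
proof -
  have "f x = g x" using assms by (rule eventually_nhds_x_imp_x)
  moreover have "\<forall>\<^sub>F y in at x. f y = g y"
    using assms by (simp add: eventually_at_filter eventually_mono)
  ultimately have "(f has_derivative f') (at x) \<longleftrightarrow> (g has_derivative f') (at x)" for f'
    using has_derivative_transform_eventually[of f f' x UNIV g]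
      has_derivative_transform_eventually[of g f' x UNIV f]
    by (auto simp: eq_commute)
  then show ?thesis by (simp add: frechet_derivative_def)
qed

lemma partial_deriv_cong_germ:
  assumes "\<forall>\<^sub>F y in nhds x. f y = g y"
  shows "\<forall>\<^sub>F y in nhds x. partial_deriv r f y = partial_deriv r g y"
proof -
  \<comment> \<open>Agreement near \<open>x\<close> is agreement near every point close to \<open>x\<close>, so that the conclusion is
    again about germs and can be iterated for second derivatives.\<close>
  have "\<forall>\<^sub>F y in nhds x. \<forall>\<^sub>F z in nhds y. f z = g z"
    using assms by (simp add: eventually_eventually)
  then show ?thesis
    by (rule eventually_mono) (simp add: partial_deriv_def frechet_derivative_cong_germ)
qed

lemma gradient_cong_germ:
  assumes "\<forall>\<^sub>F y in nhds x. f y = g y"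
  shows "gradient f x = gradient g x"
  unfolding gradient_def
  using eventually_nhds_x_imp_x[OF partial_deriv_cong_germ[OF assms]] by simp

lemma hessian_cong_germ:
  assumes "\<forall>\<^sub>F y in nhds x. f y = g y"
  shows "hessian f x = hessian g x"
  unfolding hessian_def
  using eventually_nhds_x_imp_x[OF partial_deriv_cong_germ[OF partial_deriv_cong_germ[OF assms]]]
  by simp

section \<open>Derivatives of polynomials of degree at most two\<close>

lemma partial_deriv_eqI:
  "(f has_derivative f') (at x) \<Longrightarrow> partial_deriv k f x = f' (axis k 1)"
  by (metis partial_deriv_def frechet_derivative_at)

lemma partial_deriv_const [simp]: "partial_deriv k (\<lambda>y. c) = (\<lambda>y. 0)"
  by (rule ext, subst partial_deriv_eqI[where f' = "\<lambda>_. 0"]) auto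

lemma has_derivative_coord:
  "((\<lambda>y :: real^'d. y $ r - u) has_derivative (\<lambda>h. h $ r)) (at y)"
  by (auto intro!: derivative_eq_intros bounded_linear_imp_has_derivative)

lemma partial_deriv_coord:
  "partial_deriv k (\<lambda>y :: real^'d. y $ r - u) = (\<lambda>y. axis k 1 $ r)"
  by (rule ext) (rule partial_deriv_eqI[OF has_derivative_coord])

lemma partial_deriv_quadratic:
  "partial_deriv k (\<lambda>y :: real^'d. (y $ r - u) * (y $ s - w))
     = (\<lambda>y. (y $ r - u) * axis k 1 $ s + axis k 1 $ r * (y $ s - w))"
proof
  fix y :: "real^'d"
  show "partial_deriv k (\<lambda>y :: real^'d. (y $ r - u) * (y $ s - w)) y
      = (y $ r - u) * axis k 1 $ s + axis k 1 $ r * (y $ s - w)"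
    by (rule partial_deriv_eqI[OF has_derivative_mult[OF has_derivative_coord has_derivative_coord]])
qed

lemma partial_deriv_partial_deriv_quadratic:
  "partial_deriv l (\<lambda>y :: real^'d. (y $ r - u) * axis k 1 $ s + axis k 1 $ r * (y $ s - w)) y
     = axis l 1 $ r * axis k 1 $ s + axis k 1 $ r * axis l 1 $ s"
proof (rule partial_deriv_eqI)
  show "((\<lambda>y :: real^'d. (y $ r - u) * axis k 1 $ s + axis k 1 $ r * (y $ s - w)) has_derivative
      (\<lambda>h. h $ r * axis k 1 $ s + axis k 1 $ r * h $ s)) (at y)"
    by (intro has_derivative_add has_derivative_mult_left has_derivative_mult_right
        has_derivative_coord)
qed

lemma gradient_const: "gradient (\<lambda>y. c) x = 0"
  by (simp add: gradient_def vec_eq_iff)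

lemma hessian_const: "hessian (\<lambda>y. c) x = 0"
  by (simp add: hessian_def vec_eq_iff)

lemma gradient_coord: "gradient (\<lambda>y :: real^'d. y $ r - u) x = axis r 1"
  by (simp add: partial_deriv_coord gradient_def vec_eq_iff axis_def)

lemma hessian_coord: "hessian (\<lambda>y :: real^'d. y $ r - u) x = 0"
  by (simp add: partial_deriv_coord hessian_def vec_eq_iff)

lemma gradient_quadratic:
  "gradient (\<lambda>y :: real^'d. (y $ r - u) * (y $ s - w)) x
     = (x $ s - w) *\<^sub>R axis r 1 + (x $ r - u) *\<^sub>R axis s 1"
  by (simp add: gradient_def partial_deriv_quadratic vec_eq_iff axis_def)

lemma hessian_quadratic:
  "hessian (\<lambda>y :: real^'d. (y $ r - u) * (y $ s - w)) x
     = (\<chi> l k. axis l 1 $ r * axis k 1 $ s + axis k 1 $ r * axis l 1 $ s)"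
  by (simp add: hessian_def partial_deriv_quadratic partial_deriv_partial_deriv_quadratic)

lemma diffusion_matrix_sym: "diffusion_matrix \<sigma> z $ r $ s = diffusion_matrix \<sigma> z $ s $ r"
  by (simp add: diffusion_matrix_def matrix_matrix_mult_def transpose_def mult.commute)

lemma sum_entry_axis:
  fixes a :: "real^'d^'d"
  shows "(\<Sum>k\<in>UNIV. \<Sum>l\<in>UNIV. a $ k $ l * (axis l 1 $ r * axis k 1 $ s)) = a $ s $ r"
proof -
  have "(\<Sum>k\<in>UNIV. \<Sum>l\<in>UNIV. a $ k $ l * (axis l 1 $ r * axis k 1 $ s))
      = (\<Sum>k\<in>UNIV. \<Sum>l\<in>UNIV. if l = r then if k = s then a $ s $ r else 0 else 0)"
    by (intro sum.cong) (auto simp: axis_def)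
  then show ?thesis by simp
qed

text \<open>The mixed Hessian has ones at \<open>(r, s)\<close> and \<open>(s, r)\<close>, which add up to a two at \<open>(r, r)\<close>
  when \<open>r = s\<close>; by symmetry of the diffusion matrix both cases give twice its entry.\<close>

lemma trace_diffusion_hessian_quadratic:
  "trace (diffusion_matrix \<sigma> z ** hessian (\<lambda>y :: real^'d. (y $ r - u) * (y $ s - w)) x)
     = 2 * diffusion_matrix \<sigma> z $ r $ s"
proof -
  let ?a = "diffusion_matrix \<sigma> z"
  have "trace (?a ** hessian (\<lambda>y :: real^'d. (y $ r - u) * (y $ s - w)) x)
      = (\<Sum>k\<in>UNIV. \<Sum>l\<in>UNIV. ?a $ k $ l * (axis l 1 $ r * axis k 1 $ s)
                            + ?a $ k $ l * (axis l 1 $ s * axis k 1 $ r))"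
    by (simp add: hessian_quadratic trace_def matrix_matrix_mult_def distrib_left
        mult.commute[of "axis _ _ $ r"])
  also have "\<dots> = ?a $ s $ r + ?a $ r $ s"
    by (simp only: sum.distrib sum_entry_axis)
  finally show ?thesis using diffusion_matrix_sym[of \<sigma> z s r] by simp
qed

section \<open>Block coefficients as functionals of the germ\<close>

lemma A1_off_diagonal:
  assumes "i \<noteq> j"
  shows "A1 b \<sigma> q i j g x = q i j x * g x"
proof -
  have "(\<Sum>k\<in>UNIV - {i}. q i k x * (g x * indicator {j} k)) = q i j x * g x"
  proof -
    have "(\<Sum>k\<in>UNIV - {i}. q i k x * (g x * indicator {j} k))
        = (\<Sum>k\<in>UNIV - {i}. if k = j then q i j x * g x else 0)"
      by (intro sum.cong) auto
    then show ?thesis using assms by simp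
  qed
  then show ?thesis
    using assms by (simp add: A1_def generator_def regime_lift_def gradient_const hessian_const
        trace_def matrix_matrix_mult_def)
qed

lemma A1_diagonal:
  "A1 b \<sigma> q i i g x = b (x, i) \<bullet> gradient g x
     + 1 / 2 * trace (diffusion_matrix \<sigma> (x, i) ** hessian g x) - total_rate q i x * g x"
proof -
  have "(\<Sum>j\<in>UNIV - {i}. q i j x * (g x * indicator {i} j - g x)) = - (total_rate q i x * g x)"
    by (simp add: total_rate_def sum_distrib_right sum_negf[symmetric])
  then show ?thesis
    by (simp add: A1_def generator_def regime_lift_def)
qed

lemma A1_diagonal_cong_germ:
  assumes "\<forall>\<^sub>F y in nhds x. f y = g y"
  shows "A1 b \<sigma> q i i f x = A1 b \<sigma> q i i g x"
  using gradient_cong_germ[OF assms] hessian_cong_germ[OF assms] eventually_nhds_x_imp_x[OF assms]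
  by (simp add: A1_diagonal)

lemma A1_diagonal_const: "A1 b \<sigma> q i i (\<lambda>y. c) x = - (total_rate q i x * c)"
  by (simp add: A1_diagonal gradient_const hessian_const trace_def matrix_matrix_mult_def)

lemma A1_diagonal_coord:
  "A1 b \<sigma> q i i (\<lambda>y. y $ r - u) x = b (x, i) $ r - total_rate q i x * (x $ r - u)"
  by (simp add: A1_diagonal gradient_coord hessian_coord trace_def matrix_matrix_mult_def
      inner_axis)

lemma A1_diagonal_quadratic:
  "A1 b \<sigma> q i i (\<lambda>y. (y $ r - u) * (y $ s - w)) x
     = diffusion_matrix \<sigma> (x, i) $ r $ s + (x $ s - w) * b (x, i) $ r + (x $ r - u) * b (x, i) $ s
       - total_rate q i x * ((x $ r - u) * (x $ s - w))"
  by (simp add: A1_diagonal gradient_quadratic trace_diffusion_hessian_quadratic inner_axis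
      inner_add_right)

section \<open>Recovering the coefficients from cut-off probes\<close>

lemma cutoff_at_eventually:
  assumes "cutoff_at x \<psi>"
  shows "\<forall>\<^sub>F y in nhds x. \<psi> y = 1"
  using assms unfolding cutoff_at_def eventually_nhds by blast

lemma constant_probe:
  assumes "cutoff_at x \<eta>"
  shows "i \<noteq> j \<Longrightarrow> A1 b \<sigma> q i j \<eta> x = q i j x"
    and "A1 b \<sigma> q i i \<eta> x = - total_rate q i x"
proof -
  note germ = cutoff_at_eventually[OF assms]
  show "A1 b \<sigma> q i j \<eta> x = q i j x" if "i \<noteq> j"
    using that eventually_nhds_x_imp_x[OF germ] by (simp add: A1_off_diagonal)
  show "A1 b \<sigma> q i i \<eta> x = - total_rate q i x"
    using A1_diagonal_cong_germ[OF germ] by (simp add: A1_diagonal_const)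
qed

lemma linear_probe:
  assumes "cutoff_at x \<psi>"
  shows "A1 b \<sigma> q i i (lin_probe \<psi> r) x = b (x, i) $ r - total_rate q i x * x $ r"
    and "A1 b \<sigma> q i i (centered_lin_probe \<psi> x r) x = b (x, i) $ r"
proof -
  have "\<forall>\<^sub>F y in nhds x. lin_probe \<psi> r y = y $ r - 0"
    by (rule eventually_mono[OF cutoff_at_eventually[OF assms]]) (simp add: lin_probe_def)
  from A1_diagonal_cong_germ[OF this, of b \<sigma> q i]
  show "A1 b \<sigma> q i i (lin_probe \<psi> r) x = b (x, i) $ r - total_rate q i x * x $ r"
    using A1_diagonal_coord[of b \<sigma> q i r 0 x] by simp
  have "\<forall>\<^sub>F y in nhds x. centered_lin_probe \<psi> x r y = y $ r - x $ r"
    by (rule eventually_mono[OF cutoff_at_eventually[OF assms]]) (simp add: centered_lin_probe_def)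
  from A1_diagonal_cong_germ[OF this]
  show "A1 b \<sigma> q i i (centered_lin_probe \<psi> x r) x = b (x, i) $ r"
    by (simp add: A1_diagonal_coord)
qed

lemma quadratic_probe:
  assumes "cutoff_at x \<psi>"
  shows "A1 b \<sigma> q i i (quad_probe \<psi> r s) x = diffusion_matrix \<sigma> (x, i) $ r $ s
           + x $ s * b (x, i) $ r + x $ r * b (x, i) $ s - total_rate q i x * x $ r * x $ s"
    and "A1 b \<sigma> q i i (centered_quad_probe \<psi> x r s) x = diffusion_matrix \<sigma> (x, i) $ r $ s"
proof -
  have "\<forall>\<^sub>F y in nhds x. quad_probe \<psi> r s y = (y $ r - 0) * (y $ s - 0)"
    by (rule eventually_mono[OF cutoff_at_eventually[OF assms]]) (simp add: quad_probe_def)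
  from A1_diagonal_cong_germ[OF this, of b \<sigma> q i]
  show "A1 b \<sigma> q i i (quad_probe \<psi> r s) x = diffusion_matrix \<sigma> (x, i) $ r $ s
      + x $ s * b (x, i) $ r + x $ r * b (x, i) $ s - total_rate q i x * x $ r * x $ s"
    using A1_diagonal_quadratic[of b \<sigma> q i r 0 s 0 x] by (simp add: mult.assoc)
  have "\<forall>\<^sub>F y in nhds x. centered_quad_probe \<psi> x r s y = (y $ r - x $ r) * (y $ s - x $ s)"
    by (rule eventually_mono[OF cutoff_at_eventually[OF assms]]) (simp add: centered_quad_probe_def)
  from A1_diagonal_cong_germ[OF this]
  show "A1 b \<sigma> q i i (centered_quad_probe \<psi> x r s) x = diffusion_matrix \<sigma> (x, i) $ r $ s"
    by (simp add: A1_diagonal_quadratic)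
qed

text \<open>Either family suffices: the centred linear and quadratic values are the drift and diffusion
  entries themselves, and the uncentred ones are solved successively, the constant probe giving the
  total rate, the linear ones then the drift, and the quadratic ones finally the diffusion
  matrix.\<close>

lemma probe_families_determine_coefficients:
  fixes b b' :: "(real^'d) \<times> 's::finite \<Rightarrow> real^'d"
    and \<sigma> \<sigma>' :: "(real^'d) \<times> 's \<Rightarrow> real^'r^'d"
  assumes cutoffs: "cutoff_at x \<psi>" "cutoff_at x \<psi>'" "cutoff_at x \<eta>" "cutoff_at x \<eta>'"
    and families: "probe_family b \<sigma> q \<eta> \<psi> x = probe_family b' \<sigma>' q' \<eta>' \<psi>' x \<or>
      centered_probe_family b \<sigma> q \<eta> \<psi> x = centered_probe_family b' \<sigma>' q' \<eta>' \<psi>' x"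
  shows "i \<noteq> j \<Longrightarrow> q i j x = q' i j x"
    and "b (x, i) = b' (x, i)"
    and "diffusion_matrix \<sigma> (x, i) = diffusion_matrix \<sigma>' (x, i)"
proof -
  have const: "A1 b \<sigma> q i j \<eta> x = A1 b' \<sigma>' q' i j \<eta>' x" for i j
    using families by (auto simp: probe_family_def centered_probe_family_def fun_eq_iff)
  show "q i j x = q' i j x" if "i \<noteq> j"
    using const[of i j] that cutoffs by (simp add: constant_probe)
  have rate: "total_rate q i x = total_rate q' i x"
    using const[of i i] cutoffs by (simp add: constant_probe)
  have drift: "b (x, i) $ r = b' (x, i) $ r" for r
    using families
  proof
    assume "probe_family b \<sigma> q \<eta> \<psi> x = probe_family b' \<sigma>' q' \<eta>' \<psi>' x"
    then have "A1 b \<sigma> q i i (lin_probe \<psi> r) x = A1 b' \<sigma>' q' i i (lin_probe \<psi>' r) x"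
      by (simp add: probe_family_def fun_eq_iff)
    then show ?thesis using cutoffs rate by (simp add: linear_probe)
  next
    assume "centered_probe_family b \<sigma> q \<eta> \<psi> x = centered_probe_family b' \<sigma>' q' \<eta>' \<psi>' x"
    then have "A1 b \<sigma> q i i (centered_lin_probe \<psi> x r) x
        = A1 b' \<sigma>' q' i i (centered_lin_probe \<psi>' x r) x"
      by (simp add: centered_probe_family_def fun_eq_iff)
    then show ?thesis using cutoffs by (simp add: linear_probe)
  qed
  then show "b (x, i) = b' (x, i)" by (simp add: vec_eq_iff)
  have "diffusion_matrix \<sigma> (x, i) $ r $ s = diffusion_matrix \<sigma>' (x, i) $ r $ s" for r s
    using families
  proof
    assume "probe_family b \<sigma> q \<eta> \<psi> x = probe_family b' \<sigma>' q' \<eta>' \<psi>' x"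
    then have "A1 b \<sigma> q i i (quad_probe \<psi> r s) x = A1 b' \<sigma>' q' i i (quad_probe \<psi>' r s) x"
      by (simp add: probe_family_def fun_eq_iff)
    then show ?thesis using cutoffs rate drift by (simp add: quadratic_probe)
  next
    assume "centered_probe_family b \<sigma> q \<eta> \<psi> x = centered_probe_family b' \<sigma>' q' \<eta>' \<psi>' x"
    then have "A1 b \<sigma> q i i (centered_quad_probe \<psi> x r s) x
        = A1 b' \<sigma>' q' i i (centered_quad_probe \<psi>' x r s) x"
      by (simp add: centered_probe_family_def fun_eq_iff)
    then show ?thesis using cutoffs by (simp add: quadratic_probe)
  qed
  then show "diffusion_matrix \<sigma> (x, i) = diffusion_matrix \<sigma>' (x, i)" by (simp add: vec_eq_iff)
qed

section \<open>Pointwise identification of the coefficients\<close>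

theorem proposition3p5:
  fixes b :: "(real^'d) \<times> 's::finite \<Rightarrow> real^'d"
    and \<sigma> :: "(real^'d) \<times> 's \<Rightarrow> real^'r^'d"
    and q :: "'s \<Rightarrow> 's \<Rightarrow> real^'d \<Rightarrow> real"
    and x :: "real^'d"
    and \<psi> :: "real^'d \<Rightarrow> real"
  assumes "CARD('s) \<ge> 2"
    and "regular_coefficients b \<sigma> q"
    and "cutoff_at x \<psi>"
  shows "(\<forall>\<eta>. unit_cutoff_at x \<eta> \<longrightarrow>
            (\<forall>i j. i \<noteq> j \<longrightarrow> q i j x = A1 b \<sigma> q i j \<eta> x) \<and>
            (\<forall>i. total_rate q i x = - A1 b \<sigma> q i i \<eta> x))
    \<and> (\<forall>i r. b (x, i) $ r = A1 b \<sigma> q i i (lin_probe \<psi> r) x + total_rate q i x * x $ r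
            \<and> b (x, i) $ r = A1 b \<sigma> q i i (centered_lin_probe \<psi> x r) x)
    \<and> (\<forall>i r s. diffusion_matrix \<sigma> (x, i) $ r $ s =
                  A1 b \<sigma> q i i (quad_probe \<psi> r s) x + total_rate q i x * x $ r * x $ s
                  - x $ s * b (x, i) $ r - x $ r * b (x, i) $ s
              \<and> diffusion_matrix \<sigma> (x, i) $ r $ s = A1 b \<sigma> q i i (centered_quad_probe \<psi> x r s) x)
    \<and> (\<forall>\<psi>'. cutoff_at x \<psi>' \<longrightarrow>
          (\<forall>i r. A1 b \<sigma> q i i (lin_probe \<psi>' r) x = A1 b \<sigma> q i i (lin_probe \<psi> r) x
               \<and> A1 b \<sigma> q i i (centered_lin_probe \<psi>' x r) x
                   = A1 b \<sigma> q i i (centered_lin_probe \<psi> x r) x) \<and>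
          (\<forall>i r s. A1 b \<sigma> q i i (quad_probe \<psi>' r s) x = A1 b \<sigma> q i i (quad_probe \<psi> r s) x
                 \<and> A1 b \<sigma> q i i (centered_quad_probe \<psi>' x r s) x
                   = A1 b \<sigma> q i i (centered_quad_probe \<psi> x r s) x))
    \<and> (\<forall>(b' :: (real^'d) \<times> 's \<Rightarrow> real^'d) (\<sigma>' :: (real^'d) \<times> 's \<Rightarrow> real^'r^'d) q' \<psi>' \<eta> \<eta>'.
          regular_coefficients b' \<sigma>' q' \<longrightarrow>
          cutoff_at x \<psi>' \<longrightarrow> unit_cutoff_at x \<eta> \<longrightarrow> unit_cutoff_at x \<eta>' \<longrightarrow>
          probe_family b \<sigma> q \<eta> \<psi> x = probe_family b' \<sigma>' q' \<eta>' \<psi>' x \<or>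
          centered_probe_family b \<sigma> q \<eta> \<psi> x = centered_probe_family b' \<sigma>' q' \<eta>' \<psi>' x \<longrightarrow>
          (\<forall>i j. i \<noteq> j \<longrightarrow> q i j x = q' i j x) \<and>
          (\<forall>i. b (x, i) = b' (x, i)) \<and>
          (\<forall>i. diffusion_matrix \<sigma> (x, i) = diffusion_matrix \<sigma>' (x, i)))"
proof (intro conjI, goal_cases)
  case 1
  show ?case by (auto simp: unit_cutoff_at_def constant_probe)
next
  case 2
  show ?case by (simp add: linear_probe[OF assms(3)])
next
  case 3
  show ?case by (simp add: quadratic_probe[OF assms(3)])
next
  case 4
  show ?case
  proof (intro allI impI)
    fix \<psi>' assume "cutoff_at x \<psi>'"
    note probes = linear_probe[OF this] quadratic_probe[OF this]
    show "(\<forall>i r. A1 b \<sigma> q i i (lin_probe \<psi>' r) x = A1 b \<sigma> q i i (lin_probe \<psi> r) x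
               \<and> A1 b \<sigma> q i i (centered_lin_probe \<psi>' x r) x
                   = A1 b \<sigma> q i i (centered_lin_probe \<psi> x r) x) \<and>
          (\<forall>i r s. A1 b \<sigma> q i i (quad_probe \<psi>' r s) x = A1 b \<sigma> q i i (quad_probe \<psi> r s) x
                 \<and> A1 b \<sigma> q i i (centered_quad_probe \<psi>' x r s) x
                   = A1 b \<sigma> q i i (centered_quad_probe \<psi> x r s) x)"
      by (simp only: probes linear_probe[OF assms(3)] quadratic_probe[OF assms(3)]) simp
  qed
next
  case 5
  show ?case
  proof (intro allI impI, goal_cases)
    case (1 b' \<sigma>' q' \<psi>' \<eta> \<eta>')
    then have "cutoff_at x \<eta>" "cutoff_at x \<eta>'"
      by (simp_all add: unit_cutoff_at_def)
    note determined = probe_families_determine_coefficients[OF assms(3) 1(2) this 1(5)]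
    show ?case
      by (intro conjI allI impI) (rule determined; assumption)+
  qed
qed

end
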